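(* For $s\in(0,\tfrac18)$ put $a=1-\sqrt{2s}\in(\tfrac12,1)$ and $\bar r(a)=\frac{1-2a+\sqrt{4a^2-4a+9}}{4}$, and for $r\in[0,1]$ let $\pi_1,\pi_2$ be the equilibrium profits of the prominent firm (Firm 1) and the non-prominent firm (Firm 2). There exists $\underline s\in\left(0,\tfrac18\right)$ such that for every $s\in\left[\underline s,\tfrac18\right)$, the difference $\pi_1-\pi_2$ strictly decreases as $r$ increases over $r\in[0,\bar r(a)]$.
   Context: Two firms sell one product each at zero marginal cost. Consumers (unit mass) have match values $u_1,u_2$, i.i.d. uniform on $[0,1]$. Firm 1 is prominent (searched and bought first, at no search cost); searching and buying product 2 costs $s\in(0,1/8)$; returned units are fully refunded and cost the firm $r$ each. Prices are not observed before search, so search decisions depend on the actual $p_1$ and the expected (equilibrium) price $p_2$: with $a=1-\sqrt{2s}$, a consumer buys product 2 iff $u_1<a+p_1-p_2$. Given a candidate pair $(p_1,p_2)$, the deviation profits are as follows. If Firm 1 charges $p$ instead of $p_1$, $$\pi_1(p)=(p+r)\Big[1-(a+p-p_2)+\tfrac12(a^2-p_2^2)\Big]-r .$$ If Firm 2 charges $p$ instead of $p_2$ (consumers still expect $p_2$ when deciding whether to search), $$\pi_2(p)=(p+r)\Big[(a+p_1-p_2)\big(1-(a+p-p_2)\big)+\tfrac12(a-p_2)(a-p_2+2p_1)\Big]-r(a+p_1-p_2).$$ A pair $(p_1,p_2)$ of nonnegative prices is an equilibrium if $p_1$ maximizes $\pi_1(\cdot)$ over $p\ge0$ and $p_2$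 maximizes $\pi_2(\cdot)$ over $p\ge 0$. For each $r\in[0,1]$ the paper shows there is exactly one equilibrium with $p_1,p_2\in[0,\frac{1-r}{2}]$; this is "the" equilibrium. Equilibrium profits are $\pi_1=\pi_1(p_1)$ and $\pi_2=\pi_2(p_2)$ evaluated at it. *)

theory Defs
  imports Complex_Main
begin

(* Throughout, r is the cost of a returned unit, p1 and p2 are the candidate prices of the
   prominent and the non-prominent firm, and p is a price actually charged by the firm whose
   deviation is considered.  The parameter a is the reservation value; consumers buy product 2
   iff u1 < a + p1 - p2. *)

definition reservation_value :: "real \<Rightarrow> real" where
  "reservation_value s = 1 - sqrt (2 * s)"

definition r_bar :: "real \<Rightarrow> real" where
  "r_bar a = (1 - 2 * a + sqrt (4 * a\<^sup>2 - 4 * a + 9)) / 4"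

(* The price of the prominent firm is observed before search, hence p1 does not occur here. *)
definition deviation_profit1 :: "real \<Rightarrow> real \<Rightarrow> real \<Rightarrow> real \<Rightarrow> real" where
  "deviation_profit1 a r p2 p =
     (p + r) * (1 - (a + p - p2) + (a\<^sup>2 - p2\<^sup>2) / 2) - r"

(* Search decisions depend on the expected price p2, not on the price p actually charged. *)
definition deviation_profit2 :: "real \<Rightarrow> real \<Rightarrow> real \<Rightarrow> real \<Rightarrow> real \<Rightarrow> real" where
  "deviation_profit2 a r p1 p2 p =
     (p + r) * ((a + p1 - p2) * (1 - (a + p - p2)) + (a - p2) * (a - p2 + 2 * p1) / 2)
       - r * (a + p1 - p2)"

(* is_arg_max f P x includes P x, so both prices are nonnegative. *)
definition is_equilibrium :: "real \<Rightarrow> real \<Rightarrow> real \<times> real \<Rightarrow> bool" where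
  "is_equilibrium a r = (\<lambda>(p1, p2).
     is_arg_max (deviation_profit1 a r p2) (\<lambda>p. 0 \<le> p) p1 \<and>
     is_arg_max (deviation_profit2 a r p1 p2) (\<lambda>p. 0 \<le> p) p2)"

(* Uniqueness in this square is only needed for r in [0, 1] and 1/2 < a < 1; elsewhere the
   value may be unspecified. *)
definition equilibrium :: "real \<Rightarrow> real \<Rightarrow> real \<times> real" where
  "equilibrium a r =
     (THE q. is_equilibrium a r q \<and> q \<in> {0..(1 - r) / 2} \<times> {0..(1 - r) / 2})"

definition equilibrium_profit1 :: "real \<Rightarrow> real \<Rightarrow> real" where
  "equilibrium_profit1 a r =
     (let (p1, p2) = equilibrium a r in deviation_profit1 a r p2 p1)"

definition equilibrium_profit2 :: "real \<Rightarrow> real \<Rightarrow> real" where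
  "equilibrium_profit2 a r =
     (let (p1, p2) = equilibrium a r in deviation_profit2 a r p1 p2 p2)"

end

theory Submission
  imports Defs
begin

text \<open>
  Put \<open>K = a + p1 - p2\<close>. In equilibrium \<open>\<pi>2 = K ((p2 + r)\<^sup>2 - r)\<close>, and \<open>\<pi>1 = (p1 + r)\<^sup>2 - r\<close> as
  long as the constraint \<open>p1 \<ge> 0\<close> does not bind; near \<open>a = 1/2\<close> it binds before \<open>r\<close> reaches
  \<open>r_bar a\<close>. If \<open>r\<close> grows by \<open>e\<close>, then \<open>p2\<close> falls by some \<open>d\<close> between \<open>0\<close> and \<open>e\<close>. When the
  constraint is slack, the change of \<open>p1\<close> is an explicit function of \<open>e\<close>, \<open>d\<close> and the average of
  \<open>p2\<close>, which makes the change of \<open>\<pi>1 - \<pi>2\<close> equal to \<open>(e - d) L0 + d L1\<close>, where \<open>L0\<close> and \<open>L1\<close> only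
  involve averages over the two equilibria; crude bounds show that both are negative when \<open>a\<close> is
  close to \<open>1/2\<close>. When the constraint binds, \<open>p1 = 0\<close> and \<open>p2\<close> is linear in \<open>r\<close>.
\<close>

section \<open>Best responses and the equilibrium conditions\<close>

lemma is_arg_max_concave_quadratic:
  fixes f :: "real \<Rightarrow> real"
  assumes f: "\<And>x. f x = c - k * (x - m)\<^sup>2" and k: "k > 0"
  shows "is_arg_max f (\<lambda>x. 0 \<le> x) x \<longleftrightarrow> x = max 0 m"
proof -
  have less: "f x < f y \<longleftrightarrow> \<bar>y - m\<bar> < \<bar>x - m\<bar>" for x y
    using k by (simp add: f not_le[symmetric] abs_le_square_iff)
  show ?thesis
  proof
    assume *: "is_arg_max f (\<lambda>x. 0 \<le> x) x"
    then have "0 \<le> x" "\<not> f x < f (max 0 m)"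
      by (auto simp: is_arg_max_def)
    then show "x = max 0 m"
      by (auto simp: less max_def split: if_splits)
  next
    assume "x = max 0 m"
    then show "is_arg_max f (\<lambda>x. 0 \<le> x) x"
      by (auto simp: is_arg_max_def less max_def)
  qed
qed

text \<open>
  The last equation is Firm 2's first-order condition: the constraint \<open>q \<ge> 0\<close> never binds in the
  parameter range of interest.
\<close>
definition solves :: "real \<Rightarrow> real \<Rightarrow> real \<Rightarrow> real \<Rightarrow> bool" where
  "solves a r p q \<longleftrightarrow>
     p = max 0 ((1 - a - r + q + (a\<^sup>2 - q\<^sup>2) / 2) / 2) \<and>
     0 \<le> q \<and> q \<le> (1 - r) / 2 \<and> (a - q)\<^sup>2 = 2 * (a + p - q) * (1 - r - 2 * q)"

lemma best_response1_iff:
  "is_arg_max (deviation_profit1 a r q) (\<lambda>p. 0 \<le> p) p \<longleftrightarrow>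
     p = max 0 ((1 - a - r + q + (a\<^sup>2 - q\<^sup>2) / 2) / 2)"
proof -
  let ?m = "(1 - a - r + q + (a\<^sup>2 - q\<^sup>2) / 2) / 2"
  have "deviation_profit1 a r q x = ((?m + r)\<^sup>2 - r) - 1 * (x - ?m)\<^sup>2" for x
    unfolding deviation_profit1_def by (simp add: field_simps power2_eq_square)
  from is_arg_max_concave_quadratic[OF this] show ?thesis by simp
qed

text \<open>Search depends on the expected price \<open>q\<close>, so profit is quadratic in the
  charged price, with leading coefficient -(a + p - q). The vertex is written as \<open>q\<close>
  plus a correction, so that, apart from clipping at 0, x = q means that the correction
  vanishes.\<close>

lemma best_response2_iff:
  assumes "a + p - q > 0"
  shows "is_arg_max (deviation_profit2 a r p q) (\<lambda>p. 0 \<le> p) x \<longleftrightarrow>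
     x = max 0 (q + (1 - r - 2 * q - (a - q)\<^sup>2 / (2 * (a + p - q))) / 2)"
proof -
  define K where "K = a + p - q"
  define m where "m = q + (1 - r - 2 * q - (a - q)\<^sup>2 / (2 * K)) / 2"
  have K: "K > 0" and p: "p = K - a + q" using assms by (simp_all add: K_def)
  have m: "2 * K * m = K * (1 - r) - (a - q)\<^sup>2 / 2"
    using K by (simp add: m_def field_simps)
  have bracket: "K * (1 - (a + x - q)) + (a - q) * (a - q + 2 * p) / 2 = K * (2 * m + r - x)" for x
    using m by (simp add: p field_simps power2_eq_square)
  have "deviation_profit2 a r p q x = (K * (m + r)\<^sup>2 - r * K) - K * (x - m)\<^sup>2" for x
    unfolding deviation_profit2_def K_def[symmetric] bracket
    by (simp add: field_simps power2_eq_square)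
  from is_arg_max_concave_quadratic[OF this K] show ?thesis by (simp add: m_def K_def)
qed

lemma is_equilibrium_iff_solves:
  assumes a: "1 / 2 < a" "a < 2 * (1 - r)" "a < 1" and r: "0 \<le> r"
  shows "is_equilibrium a r (p, q) \<and> (p, q) \<in> {0..(1 - r) / 2} \<times> {0..(1 - r) / 2} \<longleftrightarrow>
    solves a r p q"
proof (cases "0 \<le> p \<and> 0 \<le> q \<and> q \<le> (1 - r) / 2")
  case False
  then show ?thesis by (auto simp: solves_def)
next
  case True
  define K where "K = a + p - q"
  have K: "K > 0" using True a r by (simp add: K_def)
  have p_le: "p \<le> (1 - r) / 2" if "p = max 0 ((1 - a - r + q + (a\<^sup>2 - q\<^sup>2) / 2) / 2)"
  proof -
    have "(a - q) * (2 - (a + q)) \<ge> 0"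
      using True a r by (intro mult_nonneg_nonneg) auto
    then show ?thesis
      using that a by (simp add: field_simps power2_eq_square max_def)
  qed
  have "q = max 0 (q + (1 - r - 2 * q - (a - q)\<^sup>2 / (2 * K)) / 2) \<longleftrightarrow>
      1 - r - 2 * q = (a - q)\<^sup>2 / (2 * K)"
  proof -
    \<comment> \<open>Excludes the corner: at q = 0 one has K \<ge> a, so a < 2 (1 - r) makes the
      vertex of Firm 2's parabola positive.\<close>
    have "1 - r > a\<^sup>2 / (2 * K)" if "q = 0"
    proof -
      have "a * a < 2 * (1 - r) * a" using a by simp
      also have "\<dots> \<le> 2 * (1 - r) * K" using a True that by (intro mult_left_mono) (auto simp: K_def)
      finally show ?thesis using K by (simp add: field_simps power2_eq_square)
    qed
    then show ?thesis using True by (auto simp: max_def)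
  qed
  also have "\<dots> \<longleftrightarrow> (a - q)\<^sup>2 = 2 * K * (1 - r - 2 * q)"
    using K by (auto simp: field_simps)
  finally have "is_arg_max (deviation_profit2 a r p q) (\<lambda>p. 0 \<le> p) q \<longleftrightarrow>
      (a - q)\<^sup>2 = 2 * K * (1 - r - 2 * q)"
    using best_response2_iff[of a p q r q] K by (simp add: K_def)
  then show ?thesis
    using p_le True by (auto simp: is_equilibrium_def best_response1_iff solves_def K_def)
qed

section \<open>Comparative statics in r, uniqueness and existence\<close>

text \<open>If q rose by D > 0, p would rise by at most D, so K = a + p - q would not grow. The
  right side of Firm 2's condition would then fall by at least 2 K (r' - r + 2 D), but (a - q)^2
  falls by at most 2 K D, because p \<ge> 0 gives a - q \<le> K.\<close>

lemma solves_antimono: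
  assumes s: "solves a r p q" and s': "solves a r' p' q'"
    and a: "1 / 2 < a" and r: "0 \<le> r" "r \<le> r'"
  shows "q' \<le> q"
proof (rule ccontr)
  assume "\<not> q' \<le> q"
  define D where "D = q' - q"
  have D: "D > 0" and q': "q' = q + D" using \<open>\<not> q' \<le> q\<close> by (auto simp: D_def)
  define t where "t = a - q"
  have p: "0 \<le> p" "0 \<le> p'" using s s' by (auto simp: solves_def)
  have q: "0 \<le> q" "q' \<le> 1 / 2" using s s' r by (auto simp: solves_def)
  have t: "t - D > 0" using q a by (simp add: t_def q')
  have "D * (2 * q + D) \<ge> 0" using D q by simp
  then have "(1 - a - r' + q' + (a\<^sup>2 - q'\<^sup>2) / 2) / 2 \<le>
      (1 - a - r + q + (a\<^sup>2 - q\<^sup>2) / 2) / 2 + D"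
    using D r by (simp add: q' field_simps power2_eq_square)
  moreover have "p = max 0 ((1 - a - r + q + (a\<^sup>2 - q\<^sup>2) / 2) / 2)"
    "p' = max 0 ((1 - a - r' + q' + (a\<^sup>2 - q'\<^sup>2) / 2) / 2)"
    using s s' by (simp_all only: solves_def)
  ultimately have "p' - p \<le> D" using D by linarith
  define K where "K = t + p"
  define K' where "K' = t - D + p'"
  have K: "K' \<le> K" "0 < K'" "t \<le> K" using \<open>p' - p \<le> D\<close> p t by (auto simp: K_def K'_def)
  have w: "t\<^sup>2 = 2 * K * (1 - r - 2 * q)" "(t - D)\<^sup>2 = 2 * K' * (1 - r' - 2 * q')"
    using s s' by (auto simp: solves_def K_def K'_def t_def q' algebra_simps)
  have "(t - D)\<^sup>2 \<le> 2 * K * (1 - r' - 2 * q')"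
    unfolding w(2) using s' K by (intro mult_right_mono) (auto simp: solves_def)
  then have "2 * K * (r' - r + 2 * D) \<le> t\<^sup>2 - (t - D)\<^sup>2"
    unfolding w(1) q' by (simp add: algebra_simps)
  also have "\<dots> \<le> 2 * K * D"
  proof -
    have "t * D \<le> K * D" using K D by simp
    moreover have "(t - D)\<^sup>2 = t\<^sup>2 - 2 * (t * D) + D\<^sup>2" by (simp add: power2_diff)
    ultimately show ?thesis using zero_le_power2[of D] by linarith
  qed
  finally have "2 * K * (r' - r + D) \<le> 0" by (simp add: algebra_simps)
  moreover have "2 * K * (r' - r + D) > 0" using K r D by (intro mult_pos_pos) auto
  ultimately show False by simp
qed

lemma solves_unique:
  assumes "solves a r p q" "solves a r p' q'" "1 / 2 < a" "0 \<le> r"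
  shows "p' = p" "q' = q"
proof -
  show "q' = q"
    using solves_antimono[OF assms(1,2)] solves_antimono[OF assms(2,1)] assms(3,4) by force
  then show "p' = p" using assms(1,2) by (simp add: solves_def)
qed

text \<open>Suppose q falls by d > r' - r; then p falls by at most d. Firm 2's condition equates w =
  (a - q)^2 / (2 (a + p - q)) with 1 - r - 2 q, which grows by 2 d - (r' - r) > d, whereas the
  quotient can grow by at most d.\<close>

lemma solves_add_mono:
  assumes s: "solves a r p q" and s': "solves a r' p' q'"
    and a: "1 / 2 < a" and r: "0 \<le> r" "r \<le> r'"
  shows "q + r \<le> q' + r'"
proof (rule ccontr)
  assume "\<not> q + r \<le> q' + r'"
  define d where "d = q - q'"
  have d: "d > r' - r" and q': "q' = q - d"
    using \<open>\<not> q + r \<le> q' + r'\<close> by (auto simp: d_def)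
  define t where "t = a - q"
  have p: "0 \<le> p" "0 \<le> p'" using s s' by (auto simp: solves_def)
  have q: "0 \<le> q'" "q \<le> 1 / 2" using s s' r by (auto simp: solves_def)
  have t: "t > 0" using q a by (simp add: t_def)
  have "d * (2 * q' + d) \<ge> 0" using d r q by simp
  then have "(1 - a - r + q + (a\<^sup>2 - q\<^sup>2) / 2) / 2 \<le>
      (1 - a - r' + q' + (a\<^sup>2 - q'\<^sup>2) / 2) / 2 + d"
    using d by (simp add: q' field_simps power2_eq_square)
  moreover have "p = max 0 ((1 - a - r + q + (a\<^sup>2 - q\<^sup>2) / 2) / 2)"
    "p' = max 0 ((1 - a - r' + q' + (a\<^sup>2 - q'\<^sup>2) / 2) / 2)"
    using s s' by (simp_all only: solves_def)
  ultimately have "p - p' \<le> d" using d r by linarith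
  define w where "w = t\<^sup>2 / (2 * (t + p))"
  define w' where "w' = (t + d)\<^sup>2 / (2 * (t + d + p'))"
  have "t\<^sup>2 = 2 * (t + p) * (1 - r - 2 * q)"
    "(t + d)\<^sup>2 = 2 * (t + d + p') * (1 - r' - 2 * q')"
    using s s' unfolding solves_def t_def q' by (metis add_diff_eq diff_add_eq diff_diff_eq2)+
  then have "w = 1 - r - 2 * q" "w' = 1 - r' - 2 * q'"
    unfolding w_def w'_def using t p d r by simp_all
  then have ww: "w' - w = 2 * d - (r' - r)" by (simp add: q')
  \<comment> \<open>For large p, p' \<ge> p - d keeps the denominator from shrinking; for small p,
    p' \<ge> 0 is the better bound and limits the growth to 3 d / 4.\<close>
  have "w' - w \<le> d"
  proof (cases "d / 2 \<le> p")
    case True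
    have "w' \<le> (t + d)\<^sup>2 / (2 * (t + p))"
      unfolding w'_def using t p \<open>p - p' \<le> d\<close> by (intro divide_left_mono) auto
    also have "\<dots> = w + d * (t + d / 2) / (t + p)"
      using t p by (simp add: w_def divide_simps) (simp add: power2_eq_square algebra_simps)
    also have "d * (t + d / 2) / (t + p) \<le> d"
      using True t p d r by (simp add: pos_divide_le_eq mult_left_mono)
    finally show ?thesis by simp
  next
    case False
    have "w' \<le> (t + d)\<^sup>2 / (2 * (t + d))"
      unfolding w'_def using t p d r by (intro divide_left_mono) auto
    also have "\<dots> = (t + d) / 2" using t d r by (simp add: nonzero_divide_eq_eq power2_eq_square)
    finally have "w' \<le> (t + d) / 2" .
    moreover have "t / 2 - d / 4 \<le> w"
    proof -
      have "t / 2 - d / 4 \<le> t\<^sup>2 / (2 * t + d)"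
      proof (subst pos_le_divide_eq)
        have "(t / 2 - d / 4) * (2 * t + d) = t\<^sup>2 - d\<^sup>2 / 4"
          by (simp add: power2_eq_square algebra_simps)
        then show "(t / 2 - d / 4) * (2 * t + d) \<le> t\<^sup>2" by simp
      qed (use t d r in simp)
      also have "\<dots> \<le> w"
        unfolding w_def using False t p by (intro divide_left_mono) auto
      finally show ?thesis .
    qed
    ultimately show ?thesis using d r by simp
  qed
  then show False using ww d by simp
qed

text \<open>Intermediate value theorem for Firm 2's condition with p replaced by Firm 1's best
  response: a < 2 (1 - r) fixes the sign at q = 0, and at q = (1 - r) / 2 only a square
  remains.\<close>

lemma solves_exists:
  assumes a: "1 / 2 < a" "a < 2 * (1 - r)" "a < 1" and r: "0 \<le> r"
  shows "\<exists>p q. solves a r p q"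
proof -
  define P where "P q = max 0 ((1 - a - r + q + (a\<^sup>2 - q\<^sup>2) / 2) / 2)" for q
  define F where "F q = (a - q)\<^sup>2 - 2 * (a + P q - q) * (1 - r - 2 * q)" for q
  have "a * a \<le> 2 * (1 - r) * a" using a by simp
  also have "\<dots> \<le> 2 * (1 - r) * (a + P 0)" using a by (intro mult_left_mono) (auto simp: P_def)
  finally have "F 0 \<le> 0" by (simp add: F_def power2_eq_square algebra_simps)
  moreover have "1 - r - 2 * ((1 - r) / 2) = 0" by (simp add: field_simps)
  then have "0 \<le> F ((1 - r) / 2)" unfolding F_def by (metis diff_zero mult_zero_right zero_le_power2)
  moreover have "continuous_on {0..(1 - r) / 2} F"
    unfolding F_def P_def by (intro continuous_intros) auto
  ultimately obtain q where "0 \<le> q" "q \<le> (1 - r) / 2" "F q = 0"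
    using IVT'[of F 0 0 "(1 - r) / 2"] a by auto
  then have "solves a r (P q) q" by (simp add: solves_def F_def P_def)
  then show ?thesis by blast
qed

lemma equilibrium_eq:
  assumes "1 / 2 < a" "a < 2 * (1 - r)" "a < 1" "0 \<le> r" "solves a r p q"
  shows "equilibrium a r = (p, q)"
proof -
  have "is_equilibrium a r x \<and> x \<in> {0..(1 - r) / 2} \<times> {0..(1 - r) / 2} \<longleftrightarrow> x = (p, q)" for x
    using is_equilibrium_iff_solves[OF assms(1-4), of "fst x" "snd x"]
      solves_unique[OF assms(5) _ assms(1,4), of "fst x" "snd x"] assms(5)
    by (cases x) auto
  then show ?thesis unfolding equilibrium_def by simp
qed

section \<open>The profit difference and bounds for a near 1/2\<close>

definition profit_gap :: "real \<Rightarrow> real \<Rightarrow> real \<Rightarrow> real \<Rightarrow> real" where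
  "profit_gap a r p q = deviation_profit1 a r q p - deviation_profit2 a r p q q"

text \<open>Firm 2's demand has slope -K in its own price, K = a + p - q, so the first-order
  condition says that demand equals K times the margin q + r.\<close>

lemma deviation_profit2_solves:
  assumes "solves a r p q"
  shows "deviation_profit2 a r p q q = (a + p - q) * ((q + r)\<^sup>2 - r)"
proof -
  have "(a - q)\<^sup>2 = 2 * (a + p - q) * (1 - r - 2 * q)"
    using assms by (simp add: solves_def)
  then have "(a + p - q) * (1 - a) + (a - q) * (a - q + 2 * p) / 2 = (a + p - q) * (q + r)"
    by (simp add: field_simps power2_eq_square)
  moreover have "1 - (a + q - q) = 1 - a" by simp
  ultimately have "deviation_profit2 a r p q q =
      (q + r) * ((a + p - q) * (q + r)) - r * (a + p - q)"
    unfolding deviation_profit2_def by metis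
  then show ?thesis by (simp add: power2_eq_square algebra_simps)
qed

text \<open>Since p \<ge> 0, K \<ge> t, so Firm 2's condition t^2 = 2 K w yields w \<le> t / 2. The
  bounds follow from this and from Firm 1's condition, which reads 2 p = w + 2 q - X unless p =
  0.\<close>

lemma solves_bounds:
  assumes s: "solves a r p q" and a: "1 / 2 < a" "a \<le> 51 / 100" and r: "0 \<le> r"
  shows "p \<le> (1 - r) / 2" "a + p - q \<le> 52 / 100" "0 < a + p - q" "49 / 100 \<le> q + r"
proof -
  define w where "w = 1 - r - 2 * q"
  define t where "t = a - q"
  define K where "K = t + p"
  have p: "0 \<le> p" and q: "0 \<le> q" "q \<le> 1 / 2" using s r by (auto simp: solves_def)
  have t: "0 < t" "t \<le> 51 / 100" using q a by (auto simp: t_def)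
  have K: "t \<le> K" "0 < K" using p t by (auto simp: K_def)
  have w: "0 \<le> w" "t * t = 2 * K * w"
    using s by (auto simp: solves_def w_def t_def K_def power2_eq_square algebra_simps)
  have "t * (2 * w) \<le> K * (2 * w)" using K w by (intro mult_right_mono) auto
  then have "t * (2 * w) \<le> t * t" using w by simp
  then have wt: "2 * w \<le> t" using t by simp
  show "0 < a + p - q" using K by (simp add: K_def t_def)
  show "49 / 100 \<le> q + r" using wt q a by (simp add: w_def t_def)
  define X where "X = t * (1 - (a + q) / 2)"
  have p_cases: "p = 0 \<or> 2 * p = w + 2 * q - X"
    using s unfolding X_def by (auto simp: solves_def max_def w_def t_def field_simps power2_eq_square)
  have *: "X \<ge> t * (49 / 100)"
    unfolding X_def using t q a by (intro mult_left_mono) auto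
  then show "a + p - q \<le> 52 / 100" using p_cases wt t q a by auto
  show "p \<le> (1 - r) / 2" using p_cases * t s by (auto simp: w_def solves_def)
qed

section \<open>The regime in which Firm 1's constraint is slack\<close>

lemma profit_gap_decreasing_interior:
  assumes s: "solves a r p q" and s': "solves a r' p' q'"
    and a: "1 / 2 < a" "a \<le> 51 / 100" and r: "0 \<le> r" "r < r'" "r' \<le> 72 / 100"
    and P: "p = (1 - a - r + q + (a\<^sup>2 - q\<^sup>2) / 2) / 2"
    and P': "p' = (1 - a - r' + q' + (a\<^sup>2 - q'\<^sup>2) / 2) / 2"
  shows "profit_gap a r' p' q' < profit_gap a r p q"
proof -
  define d where "d = q - q'"
  define e where "e = r' - r"
  have "0 \<le> d" "d \<le> e" "0 < e"
    using solves_antimono[OF s s'] solves_add_mono[OF s s'] a r by (auto simp: d_def e_def)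
  define m where "m = (q + q') / 2"
  define R where "R = (r + r') / 2"
  define Y where "Y = (p + r + p' + r') / 2"
  define Z where "Z = (q + r + q' + r') / 2"
  define K where "K = ((a + p - q) + (a + p' - q')) / 2"
  define S where "S = (((q + r)\<^sup>2 - r) + ((q' + r')\<^sup>2 - r')) / 2"
  define L0 where "L0 = Y - 1 - K * (2 * Z - 1) + S / 2"
  define L1 where "L1 = Y * m - 1 + K - S * m / 2"
  note b = solves_bounds[OF s a r(1)]
  have b': "p' \<le> (1 - r') / 2" "a + p' - q' \<le> 52 / 100" "0 < a + p' - q'" "49 / 100 \<le> q' + r'"
    using solves_bounds[OF s' a] r by auto
  have q: "0 \<le> q" "q \<le> (1 - r) / 2" "0 \<le> q'" "q' \<le> (1 - r') / 2"
    using s s' by (auto simp: solves_def)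
  have R: "0 \<le> R" "R \<le> 72 / 100" using r by (auto simp: R_def)
  have m: "0 \<le> m" "m \<le> (1 - R) / 2" using q by (auto simp: m_def R_def field_simps)
  have Y: "Y \<le> (1 + R) / 2" using b b' by (auto simp: Y_def R_def field_simps)
  have K: "0 < K" "K \<le> 52 / 100" using b b' by (auto simp: K_def)
  have Z: "49 / 100 \<le> Z" using b b' by (auto simp: Z_def)
  have sq_le: "(x + y)\<^sup>2 - y \<le> (1 - y) / 4"
    if "0 \<le> x" "x \<le> (1 - y) / 2" "0 \<le> y" "y \<le> 1" for x y :: real
  proof -
    have "(x + y)\<^sup>2 \<le> ((1 + y) / 2)\<^sup>2" using that by (intro power_mono) auto
    also have "\<dots> \<le> (1 - y) / 4 + y"
    proof -
      have "y * y \<le> y" using that by (simp add: mult_left_le)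
      then show ?thesis by (simp add: field_simps power2_eq_square)
    qed
    finally show ?thesis by linarith
  qed
  have "S \<le> (1 - R) / 4"
    using sq_le[of q r] sq_le[of q' r'] q r unfolding S_def R_def by (simp add: field_simps)
  moreover have "K * (2 * Z - 1) \<ge> - (2 / 100)"
  proof -
    have "K * (2 * Z - 1) \<ge> K * (- 2 / 100)" using K Z by (intro mult_left_mono) auto
    then show ?thesis using K by simp
  qed
  \<comment> \<open>The bounds add up to L0 \<le> - 3 (1 - R) / 8 + 1 / 50, negative for R \<le>
    72/100.\<close>
  ultimately have L0: "L0 < 0" unfolding L0_def using Y R by simp
  have "S \<ge> - R" unfolding S_def R_def by (simp add: field_simps)
  then have "- S * m \<le> R * m" using m by (intro mult_right_mono) auto
  moreover have "Y * m \<le> (1 + R) / 2 * m" using Y m by (intro mult_right_mono) auto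
  moreover have "(1 + 2 * R) * m \<le> (1 + 2 * R) * ((1 - R) / 2)"
    using R m by (intro mult_left_mono) auto
  \<comment> \<open>The maximum is at R = 1/4; it gives L1 \<le> 9/32 - 1 + 52/100.\<close>
  moreover have "(1 + 2 * R) * (1 - R) \<le> 9 / 8"
    using zero_le_power2[of "R - 1 / 4"] by (simp add: power2_eq_square algebra_simps)
  ultimately have L1: "L1 < 0" unfolding L1_def using K R m by (simp add: algebra_simps)
  have br: "1 - (a + p - q) + (a\<^sup>2 - q\<^sup>2) / 2 = p + r"
    and br': "1 - (a + p' - q') + (a\<^sup>2 - q'\<^sup>2) / 2 = p' + r'"
    using P P' by (simp_all add: field_simps)
  have gap: "profit_gap a r p q = (p + r)\<^sup>2 - r - (a + p - q) * ((q + r)\<^sup>2 - r)"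
    unfolding profit_gap_def deviation_profit2_solves[OF s] deviation_profit1_def
    unfolding br by (simp add: power2_eq_square)
  have gap': "profit_gap a r' p' q' = (p' + r')\<^sup>2 - r' - (a + p' - q') * ((q' + r')\<^sup>2 - r')"
    unfolding profit_gap_def deviation_profit2_solves[OF s'] deviation_profit1_def
    unfolding br' by (simp add: power2_eq_square)
  \<comment> \<open>The squares in Firm 1's condition contribute (q^2 - q'^2) / 2 = d m.\<close>
  have dp: "p' = p - (e + d * (1 - m)) / 2"
    unfolding P P' d_def e_def m_def by (simp add: field_simps power2_eq_square)
  have dY: "p' + r' - (p + r) = (e - d + d * m) / 2"
    and dK: "a + p' - q' - (a + p - q) = - (e - d - d * m) / 2"
    and dZ: "q' + r' - (q + r) = e - d"
    unfolding dp by (simp_all add: d_def e_def field_simps)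
  \<comment> \<open>\<open>x' y' - x y = avg x (y' - y) + avg y (x' - x)\<close>, applied to every product\<close>
  have "profit_gap a r' p' q' - profit_gap a r p q =
      2 * Y * (p' + r' - (p + r)) - e - K * (2 * Z * (q' + r' - (q + r)) - e)
        - S * (a + p' - q' - (a + p - q))"
    unfolding gap gap' Y_def K_def Z_def S_def e_def by (simp add: field_simps power2_eq_square)
  also have "\<dots> = (e - d) * L0 + d * L1"
    unfolding dY dK dZ L0_def L1_def by (simp add: field_simps)
  also have "\<dots> < 0"
  proof (cases "d = 0")
    case True
    then show ?thesis using L0 \<open>0 < e\<close> by (simp add: mult_pos_neg)
  next
    case False
    then have "d * L1 < 0" using L1 \<open>0 \<le> d\<close> by (simp add: mult_pos_neg)
    moreover have "(e - d) * L0 \<le> 0" using L0 \<open>d \<le> e\<close> by (simp add: mult_nonneg_nonpos)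
    ultimately show ?thesis by simp
  qed
  finally show ?thesis by simp
qed

section \<open>The regime with p1 = 0\<close>

text \<open>The gap factors as (a - q) b. As r grows, the positive factor a - q increases while b,
  already negative, decreases.\<close>

lemma profit_gap_decreasing_clipped:
  assumes s: "solves a r 0 q" and s': "solves a r' 0 q'"
    and a: "1 / 2 < a" "a \<le> 51 / 100" and r: "0 \<le> r" "r < r'" "r' \<le> 72 / 100"
    and q: "q \<le> 1 / 10"
  shows "profit_gap a r' 0 q' < profit_gap a r 0 q"
proof -
  define b where "b r q = r * (a + q) / 2 - (q + r)\<^sup>2" for r q
  have gap: "profit_gap a r 0 q = (a - q) * b r q" if "solves a r 0 q" for r q
    unfolding profit_gap_def deviation_profit2_solves[OF that] deviation_profit1_def b_def
    by (simp add: field_simps power2_eq_square)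
  have r_eq: "r = 1 - a / 2 - 3 * q / 2" if "solves a r 0 q" "0 \<le> r" for r q
  proof -
    have "(a - q) * (a - q) = (a - q) * (2 * (1 - r - 2 * q))" "a - q \<noteq> 0"
      using that a by (auto simp: solves_def power2_eq_square algebra_simps)
    then have "a - q = 2 * (1 - r - 2 * q)" by (metis mult_left_cancel)
    then show ?thesis by simp
  qed
  \<comment> \<open>Along r = 1 - a / 2 - 3 q / 2, raising r by 3 e lowers q by 2 e.\<close>
  define e where "e = (r' - r) / 3"
  have e: "e > 0" "r = r' - 3 * e" using r by (auto simp: e_def diff_divide_distrib)
  have q_eq: "q = q' + 2 * e" using r_eq[OF s] r_eq[OF s'] r by (simp add: e_def field_simps)
  have z: "49 / 100 \<le> q + r" using solves_bounds[OF s a] r by auto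
  have q': "0 \<le> q'" using s' by (simp add: solves_def)
  have "b r q < 0"
  proof -
    have "r * (a + q) \<le> (72 / 100) * (61 / 100)" using r a q q' q_eq e by (intro mult_mono) auto
    moreover have "(49 / 100)\<^sup>2 \<le> (q + r)\<^sup>2" using z by (intro power_mono) auto
    ultimately show ?thesis by (simp add: b_def power2_eq_square)
  qed
  have "b r' q' < b r q"
  proof -
    define x where "x = 3 * (a + q) / 2 - r' - (2 * (q + r) + e)"
    have "b r' q' - b r q = e * x"
      unfolding b_def x_def q_eq e(2) by (simp add: field_simps power2_eq_square)
    moreover have "x < 0"
      unfolding x_def using z a(2) q e(1) r(1,2) by (simp add: field_simps)
    ultimately show ?thesis using mult_pos_neg[of e x] e(1) by simp
  qed
  have "(a - q') * b r' q' < (a - q') * b r q"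
    using \<open>b r' q' < b r q\<close> a q e q_eq by (intro mult_strict_left_mono) auto
  also have "\<dots> \<le> (a - q) * b r q"
    using \<open>b r q < 0\<close> e q_eq by (intro mult_right_mono_neg) auto
  finally show ?thesis using gap s s' by simp
qed

section \<open>Joining the two regimes\<close>

text \<open>The point where Firm 1's unclipped best response is exactly 0. It belongs to both
  regimes, so the two monotonicity results can be chained there.\<close>

lemma solves_threshold:
  assumes a: "1 / 2 < a" "a \<le> 51 / 100"
  obtains r q where "solves a r 0 q" "0 \<le> r" "r \<le> 72 / 100" "0 \<le> q" "q \<le> 1 / 10"
    "1 - a - r + q + (a\<^sup>2 - q\<^sup>2) / 2 = 0"
proof -
  \<comment> \<open>with \<open>p = 0\<close>, Firm 2's condition gives \<open>r = 1 - a / 2 - 3 q / 2\<close>; \<open>F q = 0\<close> is then Firm 1's\<close>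
  define F where "F q = a\<^sup>2 - a - q\<^sup>2 + 5 * q" for q :: real
  \<comment> \<open>Since a^2 - a is close to -1/4, F changes sign on [4/100, 1/10]. The lower end
    keeps r below 72/100.\<close>
  have "(a - 1 / 2)\<^sup>2 \<le> (1 / 100)\<^sup>2" using a by (intro power_mono) auto
  then have "F (4 / 100) \<le> 0" by (simp add: F_def power2_eq_square algebra_simps)
  moreover have "0 \<le> F (1 / 10)"
    using zero_le_power2[of "a - 1 / 2"] by (simp add: F_def power2_eq_square algebra_simps)
  moreover have "continuous_on {4 / 100..1 / 10} F"
    unfolding F_def by (intro continuous_intros)
  ultimately obtain q where q: "4 / 100 \<le> q" "q \<le> 1 / 10" "F q = 0"
    using IVT'[of F "4 / 100" 0 "1 / 10"] by auto
  define r where "r = 1 - a / 2 - 3 * q / 2"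
  have 0: "1 - a - r + q + (a\<^sup>2 - q\<^sup>2) / 2 = 0"
    using q(3) by (simp add: r_def F_def field_simps)
  have "solves a r 0 q"
    unfolding solves_def 0 using q a by (simp add: r_def power2_eq_square algebra_simps)
  then show ?thesis
    using that[of r q] 0 q a by (simp add: r_def)
qed

lemma profit_gap_decreasing:
  assumes s: "solves a r p q" and s': "solves a r' p' q'"
    and a: "1 / 2 < a" "a \<le> 51 / 100" and r: "0 \<le> r" "r < r'" "r' \<le> 72 / 100"
  shows "profit_gap a r' p' q' < profit_gap a r p q"
proof -
  define B where "B r q = 1 - a - r + q + (a\<^sup>2 - q\<^sup>2) / 2" for r q
  have p_eq: "p = max 0 (B r q / 2)" if "solves a r p q" for r p q
    using that by (simp add: solves_def B_def)
  obtain r0 q0 where s0: "solves a r0 0 q0" and r0: "0 \<le> r0" "r0 \<le> 72 / 100"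
    and q0: "0 \<le> q0" "q0 \<le> 1 / 10" and B0: "B r0 q0 = 0"
    using solves_threshold[OF a] unfolding B_def by metis
  have B_anti: "B r' q' \<le> B r q"
    if "solves a r p q" "solves a r' p' q'" "0 \<le> r" "r \<le> r'" for r p q r' p' q'
  proof -
    have "q' \<le> q" using solves_antimono[OF that(1,2)] that a by simp
    moreover have "q + q' \<le> 1" using that by (simp add: solves_def)
    ultimately have "0 \<le> (q - q') * (2 - (q + q'))" by (intro mult_nonneg_nonneg) auto
    then show ?thesis using that by (simp add: B_def field_simps power2_eq_square)
  qed
  have interior: "p = B r q / 2" if "solves a r p q" "0 \<le> r" "r \<le> r0" for r p q
    using B_anti[OF that(1) s0] p_eq[OF that(1)] B0 that by simp
  have clipped: "p = 0" if "solves a r p q" "r0 \<le> r" for r p q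
    using B_anti[OF s0 that(1)] p_eq[OF that(1)] B0 r0 that by simp
  have left: "profit_gap a r' p' q' < profit_gap a r p q"
    if "solves a r p q" "solves a r' p' q'" "0 \<le> r" "r < r'" "r' \<le> r0" for r p q r' p' q'
    by (rule profit_gap_decreasing_interior[OF that(1,2) a])
      (use that r0 interior[OF that(1)] interior[OF that(2)] in \<open>auto simp: B_def\<close>)
  have right: "profit_gap a r' p' q' < profit_gap a r p q"
    if "solves a r p q" "solves a r' p' q'" "r0 \<le> r" "r < r'" "r' \<le> 72 / 100" for r p q r' p' q'
  proof -
    have "p = 0" "p' = 0" using clipped that by auto
    moreover have "q \<le> 1 / 10" using solves_antimono[OF s0 that(1)] a r0 q0 that by simp
    ultimately show ?thesis
      using profit_gap_decreasing_clipped[of a r q r' q'] that a r0 by simp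
  qed
  consider "r' \<le> r0" | "r0 \<le> r" | "r < r0" "r0 < r'" by linarith
  then show ?thesis
  proof cases
    case 1
    then show ?thesis using left[OF s s'] r by simp
  next
    case 2
    then show ?thesis using right[OF s s'] r by simp
  next
    case 3
    then show ?thesis using left[OF s s0] right[OF s0 s'] r by simp
  qed
qed

section \<open>Numerical ranges and conclusion\<close>

lemma r_bar_le:
  assumes "1 / 2 \<le> a"
  shows "r_bar a \<le> 72 / 100"
proof -
  \<comment> \<open>188/100 = 4 * 72/100 - 1; at a = 1/2 the exact value of \<open>r_bar\<close> is
    sqrt 2 / 2, about 0.707.\<close>
  have "4 * a\<^sup>2 - 4 * a + 9 \<le> (2 * a + 188 / 100)\<^sup>2"
    using assms by (simp add: power2_eq_square algebra_simps)
  then have "sqrt (4 * a\<^sup>2 - 4 * a + 9) \<le> 2 * a + 188 / 100"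
    using assms by (intro real_le_lsqrt) auto
  then show ?thesis by (simp add: r_bar_def)
qed

text \<open>Explains the witness 121/1000 for \<open>s_low\<close>: 2 s \<ge> 0.242 exceeds 0.49^2 =
  0.2401.\<close>

lemma reservation_value_bounds:
  assumes "121 / 1000 \<le> s" "s < 1 / 8"
  shows "1 / 2 < reservation_value s" "reservation_value s \<le> 51 / 100"
proof -
  show "1 / 2 < reservation_value s"
    using assms real_less_lsqrt[of "1 / 2" "2 * s"]
    by (simp add: reservation_value_def power2_eq_square)
  have "49 / 100 \<le> sqrt (2 * s)"
    using assms by (intro real_le_rsqrt) (simp add: power2_eq_square)
  then show "reservation_value s \<le> 51 / 100" by (simp add: reservation_value_def)
qed

theorem proposition5:
  shows "\<exists>s_low \<in> {0 <..< 1/8 :: real}. \<forall>s \<in> {s_low ..< 1/8}.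
           let a = reservation_value s in
             strict_antimono_on {0 .. r_bar a}
               (\<lambda>r. equilibrium_profit1 a r - equilibrium_profit2 a r)"
proof (intro bexI[of _ "121 / 1000"] ballI)
  fix s :: real
  assume "s \<in> {121 / 1000 ..< 1/8}"
  define a where "a = reservation_value s"
  have a: "1 / 2 < a" "a \<le> 51 / 100"
    using reservation_value_bounds \<open>s \<in> _\<close> by (auto simp: a_def)
  have gap: "\<exists>p q. solves a r p q \<and>
      equilibrium_profit1 a r - equilibrium_profit2 a r = profit_gap a r p q"
    if r: "0 \<le> r" "r \<le> 72 / 100" for r
  proof -
    \<comment> \<open>2 (1 - 72/100) = 56/100 exceeds 51/100.\<close>
    have ar: "a < 2 * (1 - r)" "a < 1" using a r by auto
    obtain p q where "solves a r p q" using solves_exists[OF a(1) ar r(1)] by blast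
    then show ?thesis
      using equilibrium_eq[OF a(1) ar r(1)]
      by (auto simp: equilibrium_profit1_def equilibrium_profit2_def profit_gap_def)
  qed
  have "strict_antimono_on {0 .. r_bar a}
      (\<lambda>r. equilibrium_profit1 a r - equilibrium_profit2 a r)"
  proof (rule monotone_onI)
    fix r r' :: real
    assume "r \<in> {0 .. r_bar a}" "r' \<in> {0 .. r_bar a}" "r < r'"
    then have r: "0 \<le> r" "r < r'" "r' \<le> 72 / 100" using r_bar_le[of a] a by auto
    obtain p q where 1: "solves a r p q"
      "equilibrium_profit1 a r - equilibrium_profit2 a r = profit_gap a r p q"
      using gap[of r] r by auto
    obtain p' q' where 2: "solves a r' p' q'"
      "equilibrium_profit1 a r' - equilibrium_profit2 a r' = profit_gap a r' p' q'"
      using gap[of r'] r by auto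
    show "equilibrium_profit1 a r' - equilibrium_profit2 a r' <
        equilibrium_profit1 a r - equilibrium_profit2 a r"
      unfolding 1(2) 2(2) by (rule profit_gap_decreasing[OF 1(1) 2(1) a r])
  qed
  then show "let a = reservation_value s in strict_antimono_on {0 .. r_bar a}
      (\<lambda>r. equilibrium_profit1 a r - equilibrium_profit2 a r)"
    by (simp add: a_def Let_def)
qed simp

end
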